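(* Let $(Z_1,Z_0,\varphi_Z)$ be a Zinbiel 2-algebra and $(E_1,E_0,\varphi_E)$ a 2-vector space. Then any Zinbiel 2-algebra structure on $(E_1,E_0,\varphi_E)$ such that $(E_1,E_0,\varphi_E)$ contains $(Z_1,Z_0,\varphi_Z)$ as an ideal is isomorphic to a crossed product $Z\#^{\omega}V$.
   Context: All vector spaces are over an algebraically closed field $k$ of characteristic different from 2 and 3. A Zinbiel algebra is a vector space $Z$ with a bilinear multiplication $\cdot$ satisfying $(x\cdot y)\cdot z=x\cdot(y\cdot z+z\cdot y)$. A bimodule of a Zinbiel algebra $Z$ is a vector space $V$ with bilinear maps $\triangleright:Z\times V\to V$, $\triangleleft:V\times Z\to V$ such that $(x\cdot y)\triangleright v=x\triangleright(y\triangleright v+v\triangleleft y)$, $(v\triangleleft x)\triangleleft y=v\triangleleft(x\cdot y+y\cdot x)$, $(x\triangleright v)\triangleleft y=x\triangleright(v\triangleleft y+y\triangleright v)$. A Zinbiel algebra $Z_0$ acts on a Zinbiel algebra $Z_1$ if there are bilinear maps $\triangleright:Z_0\times Z_1\to Z_1$, $\triangleleft:Z_1\times Z_0\to Z_1$ making $Z_1$ a $Z_0$-bimodule and such that $(x_0\triangleright x_1)\cdot y_1=x_0\triangleright(x_1\cdot y_1+y_1\cdot x_1)$, $(x_1\triangleleft x_0)\cdot y_1=x_1\cdot(x_0\triangleright y_1+y_1\triangleleft x_0)$, $(x_1\cdot y_1)\triangleleft x_0=x_1\cdot(y_1\triangleleft x_0+x_0\triangleright y_1)$. A (strict) Zinbiel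 2-algebra (= crossed module of Zinbiel algebras) $(Z_1,Z_0,\varphi)$ is a homomorphism of Zinbiel algebras $\varphi:Z_1\to Z_0$ with an action of $Z_0$ on $Z_1$ such that $\varphi(x_0\triangleright x_1)=x_0\cdot\varphi(x_1)$, $\varphi(x_1\triangleleft x_0)=\varphi(x_1)\cdot x_0$, $\varphi(x_1)\triangleright y_1=x_1\cdot y_1=x_1\triangleleft\varphi(y_1)$. Inside a given Zinbiel 2-algebra $(Z_1,Z_0,\varphi)$ the actions are also written $x_0\cdot x_1:=x_0\triangleright x_1$ and $x_1\cdot x_0:=x_1\triangleleft x_0$. An isomorphism $(Z_1,Z_0,\varphi)\to(Z_1',Z_0',\varphi')$ is a pair $\phi=(\phi_1,\phi_0)$ of bijective Zinbiel algebra homomorphisms $\phi_i:Z_i\to Z_i'$ with $\varphi'\circ\phi_1=\phi_0\circ\varphi$ that preserves the actions: $\phi_1(x_0\triangleright x_1)=\phi_0(x_0)\triangleright\phi_1(x_1)$, $\phi_1(x_1\triangleleft x_0)=\phi_1(x_1)\triangleleft\phi_0(x_0)$. $(Z_1',Z_0',\varphi')$ is a subalgebra of $(Z_1,Z_0,\varphi)$ if $Z_i'$ is a subalgebra of $Z_i$, $\varphi|_{Z_1'}=\varphi'$, and the actions are the restricted ones. $(Z_1,Z_0,\varphi_Z)$ is an ideal of a Zinbiel 2-algebra $(E_1,E_0,\varphi_E)$ if it is a subalgebra, $Z_i$ is a two-sided ideal of $E_i$ ($i=0,1$), and $E_0\triangleright Z_1$, $Z_1\triangleleft E_0$, $Z_0\triangleright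 E_1$, $E_1\triangleleft Z_0$ are all contained in $Z_1$. A 2-vector space $(V_1,V_0,d)$ is a pair of vector spaces with a linear map $d:V_1\to V_0$. A crossed system of $(Z_1,Z_0,\varphi)$ by a 2-vector space $(V_1,V_0,d)$ consists of a linear map $\sigma:V_1\to Z_0$ and, for $j=0,1,2,3$, bilinear maps $\rightharpoonup_j:V_a\times Z_b\to Z_c$, $\leftharpoonup_j:Z_a\times V_b\to Z_c$, $\omega_j:V_a\times V_b\to Z_c$, $\ast_j:V_a\times V_b\to V_c$, where $(a,b,c)=(0,0,0),(1,1,1),(0,1,1),(1,0,1)$ for $j=0,1,2,3$ respectively, such that the following operations on $Z_i\oplus V_i$ ($i=0,1$) form a Zinbiel 2-algebra, called the crossed product $Z\#^{\omega}V$: structure map $(x,u)\mapsto(\varphi(x)+\sigma(u),d(u))$ for $x\in Z_1$, $u\in V_1$; $(x_i,u_i)\circ_i(y_i,v_i)=(x_i\cdot y_i+x_i\leftharpoonup_i v_i+u_i\rightharpoonup_i y_i+\omega_i(u_i,v_i),\ u_i\ast_i v_i)$, $i=0,1$; $(x_0,u_0)\triangleright(x_1,u_1)=(x_0\cdot x_1+x_0\leftharpoonup_2 u_1+u_0\rightharpoonup_2 x_1+\omega_2(u_0,u_1),\ u_0\ast_2 u_1)$; $(x_1,u_1)\triangleleft(x_0,u_0)=(x_1\cdot x_0+x_1\leftharpoonup_3 u_0+u_1\rightharpoonup_3 x_0+\omega_3(u_1,u_0),\ u_1\ast_3 u_0)$. "A crossed product $Z\#^{\omega}V$" means the crossed product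 for some 2-vector space $(V_1,V_0,d)$ and some crossed system. *)

theory Defs
  imports
    "HOL-Computational_Algebra.Computational_Algebra"
    "HOL-Library.Product_Plus"
begin

text \<open>
  Since ideals and complements have to be spoken of as objects, a vector space is a linear subspace
  of an ambient vector space whose elements form a whole type; the ambient space itself is the case
  \<open>vecs V = UNIV\<close>. Conditions on maps are imposed on the carriers only.
\<close>

record ('k, 'a) vspace =
  vecs :: "'a set"
  scl :: "'k \<Rightarrow> 'a \<Rightarrow> 'a"

definition is_vspace :: "('k::field, 'a::ab_group_add) vspace \<Rightarrow> bool" where
  "is_vspace V \<longleftrightarrow> vector_space (scl V) \<and> module.subspace (scl V) (vecs V)"

definition sub_vspace ::
  "('k::field, 'a::ab_group_add) vspace \<Rightarrow> ('k, 'a) vspace \<Rightarrow> bool" where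
  "sub_vspace U V \<longleftrightarrow> is_vspace U \<and> is_vspace V \<and> vecs U \<subseteq> vecs V \<and>
     (\<forall>c. \<forall>x \<in> vecs U. scl U c x = scl V c x)"

definition linear_map ::
  "('k::field, 'a::ab_group_add) vspace \<Rightarrow> ('k, 'b::ab_group_add) vspace \<Rightarrow> ('a \<Rightarrow> 'b) \<Rightarrow> bool" where
  "linear_map V W f \<longleftrightarrow>
     (\<forall>x \<in> vecs V. f x \<in> vecs W) \<and>
     (\<forall>x \<in> vecs V. \<forall>y \<in> vecs V. f (x + y) = f x + f y) \<and>
     (\<forall>c. \<forall>x \<in> vecs V. f (scl V c x) = scl W c (f x))"

definition bilinear_map ::
  "('k::field, 'a::ab_group_add) vspace \<Rightarrow> ('k, 'b::ab_group_add) vspace \<Rightarrow>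
   ('k, 'c::ab_group_add) vspace \<Rightarrow> ('a \<Rightarrow> 'b \<Rightarrow> 'c) \<Rightarrow> bool" where
  "bilinear_map U V W f \<longleftrightarrow>
     (\<forall>x \<in> vecs U. linear_map V W (\<lambda>y. f x y)) \<and>
     (\<forall>y \<in> vecs V. linear_map U W (\<lambda>x. f x y))"

definition direct_sum ::
  "('k::field, 'a::ab_group_add) vspace \<Rightarrow> ('k, 'b::ab_group_add) vspace \<Rightarrow> ('k, 'a \<times> 'b) vspace" where
  "direct_sum V W =
     \<lparr>vecs = vecs V \<times> vecs W, scl = (\<lambda>c (x, u). (scl V c x, scl W c u))\<rparr>"

definition zinbiel_algebra ::
  "('k::field, 'a::ab_group_add) vspace \<Rightarrow> ('a \<Rightarrow> 'a \<Rightarrow> 'a) \<Rightarrow> bool" where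
  "zinbiel_algebra Z m \<longleftrightarrow>
     is_vspace Z \<and> bilinear_map Z Z Z m \<and>
     (\<forall>x \<in> vecs Z. \<forall>y \<in> vecs Z. \<forall>z \<in> vecs Z. m (m x y) z = m x (m y z + m z y))"

definition zinbiel_hom ::
  "('k::field, 'a::ab_group_add) vspace \<Rightarrow> ('a \<Rightarrow> 'a \<Rightarrow> 'a) \<Rightarrow>
   ('k, 'b::ab_group_add) vspace \<Rightarrow> ('b \<Rightarrow> 'b \<Rightarrow> 'b) \<Rightarrow> ('a \<Rightarrow> 'b) \<Rightarrow> bool" where
  "zinbiel_hom Z m W n f \<longleftrightarrow>
     linear_map Z W f \<and> (\<forall>x \<in> vecs Z. \<forall>y \<in> vecs Z. f (m x y) = n (f x) (f y))"

definition zinbiel_bimodule ::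
  "('k::field, 'b::ab_group_add) vspace \<Rightarrow> ('b \<Rightarrow> 'b \<Rightarrow> 'b) \<Rightarrow> ('k, 'a::ab_group_add) vspace \<Rightarrow>
   ('b \<Rightarrow> 'a \<Rightarrow> 'a) \<Rightarrow> ('a \<Rightarrow> 'b \<Rightarrow> 'a) \<Rightarrow> bool" where
  "zinbiel_bimodule Z m V l r \<longleftrightarrow>
     is_vspace V \<and> bilinear_map Z V V l \<and> bilinear_map V Z V r \<and>
     (\<forall>x \<in> vecs Z. \<forall>y \<in> vecs Z. \<forall>v \<in> vecs V.
        l (m x y) v = l x (l y v + r v y) \<and>
        r (r v x) y = r v (m x y + m y x) \<and>
        r (l x v) y = l x (r v y + l y v))"

definition zinbiel_action ::
  "('k::field, 'b::ab_group_add) vspace \<Rightarrow> ('b \<Rightarrow> 'b \<Rightarrow> 'b) \<Rightarrow>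
   ('k, 'a::ab_group_add) vspace \<Rightarrow> ('a \<Rightarrow> 'a \<Rightarrow> 'a) \<Rightarrow>
   ('b \<Rightarrow> 'a \<Rightarrow> 'a) \<Rightarrow> ('a \<Rightarrow> 'b \<Rightarrow> 'a) \<Rightarrow> bool" where
  "zinbiel_action Z0 m0 Z1 m1 l r \<longleftrightarrow>
     zinbiel_bimodule Z0 m0 Z1 l r \<and>
     (\<forall>x0 \<in> vecs Z0. \<forall>x1 \<in> vecs Z1. \<forall>y1 \<in> vecs Z1.
        m1 (l x0 x1) y1 = l x0 (m1 x1 y1 + m1 y1 x1) \<and>
        m1 (r x1 x0) y1 = m1 x1 (l x0 y1 + r y1 x0) \<and>
        r (m1 x1 y1) x0 = m1 x1 (r y1 x0 + l x0 y1))"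

record ('k, 'a, 'b) two_space =
  sp1 :: "('k, 'a) vspace"
  sp0 :: "('k, 'b) vspace"
  bdry :: "'a \<Rightarrow> 'b"

definition is_two_space ::
  "('k::field, 'a::ab_group_add, 'b::ab_group_add, 'm) two_space_scheme \<Rightarrow> bool" where
  "is_two_space V \<longleftrightarrow>
     is_vspace (sp1 V) \<and> is_vspace (sp0 V) \<and> linear_map (sp1 V) (sp0 V) (bdry V)"

record ('k, 'a, 'b) two_alg = "('k, 'a, 'b) two_space" +
  mul1 :: "'a \<Rightarrow> 'a \<Rightarrow> 'a"
  mul0 :: "'b \<Rightarrow> 'b \<Rightarrow> 'b"
  lact :: "'b \<Rightarrow> 'a \<Rightarrow> 'a"
  ract :: "'a \<Rightarrow> 'b \<Rightarrow> 'a"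

definition zinbiel_2_algebra ::
  "('k::field, 'a::ab_group_add, 'b::ab_group_add) two_alg \<Rightarrow> bool" where
  "zinbiel_2_algebra Z \<longleftrightarrow>
     zinbiel_algebra (sp1 Z) (mul1 Z) \<and>
     zinbiel_algebra (sp0 Z) (mul0 Z) \<and>
     zinbiel_hom (sp1 Z) (mul1 Z) (sp0 Z) (mul0 Z) (bdry Z) \<and>
     zinbiel_action (sp0 Z) (mul0 Z) (sp1 Z) (mul1 Z) (lact Z) (ract Z) \<and>
     (\<forall>x0 \<in> vecs (sp0 Z). \<forall>x1 \<in> vecs (sp1 Z).
        bdry Z (lact Z x0 x1) = mul0 Z x0 (bdry Z x1) \<and>
        bdry Z (ract Z x1 x0) = mul0 Z (bdry Z x1) x0) \<and>
     (\<forall>x1 \<in> vecs (sp1 Z). \<forall>y1 \<in> vecs (sp1 Z).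
        lact Z (bdry Z x1) y1 = mul1 Z x1 y1 \<and>
        mul1 Z x1 y1 = ract Z x1 (bdry Z y1))"

definition zinbiel_2_iso ::
  "('k::field, 'a::ab_group_add, 'b::ab_group_add) two_alg \<Rightarrow>
   ('k, 'c::ab_group_add, 'd::ab_group_add) two_alg \<Rightarrow> ('a \<Rightarrow> 'c) \<Rightarrow> ('b \<Rightarrow> 'd) \<Rightarrow> bool" where
  "zinbiel_2_iso Z W f1 f0 \<longleftrightarrow>
     zinbiel_hom (sp1 Z) (mul1 Z) (sp1 W) (mul1 W) f1 \<and>
     bij_betw f1 (vecs (sp1 Z)) (vecs (sp1 W)) \<and>
     zinbiel_hom (sp0 Z) (mul0 Z) (sp0 W) (mul0 W) f0 \<and>
     bij_betw f0 (vecs (sp0 Z)) (vecs (sp0 W)) \<and>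
     (\<forall>x1 \<in> vecs (sp1 Z). bdry W (f1 x1) = f0 (bdry Z x1)) \<and>
     (\<forall>x0 \<in> vecs (sp0 Z). \<forall>x1 \<in> vecs (sp1 Z).
        f1 (lact Z x0 x1) = lact W (f0 x0) (f1 x1) \<and>
        f1 (ract Z x1 x0) = ract W (f1 x1) (f0 x0))"

definition zinbiel_2_isomorphic ::
  "('k::field, 'a::ab_group_add, 'b::ab_group_add) two_alg \<Rightarrow>
   ('k, 'c::ab_group_add, 'd::ab_group_add) two_alg \<Rightarrow> bool" where
  "zinbiel_2_isomorphic Z W \<longleftrightarrow> (\<exists>f1 f0. zinbiel_2_iso Z W f1 f0)"

text \<open>
  Closure of the carriers of \<open>Z\<close> under the operations of \<open>E\<close> is implied: \<open>Z\<close> is itself a Zinbiel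
  2-algebra and its operations are the restrictions of those of \<open>E\<close>.
\<close>

definition zinbiel_2_subalgebra ::
  "('k::field, 'a::ab_group_add, 'b::ab_group_add) two_alg \<Rightarrow> ('k, 'a, 'b) two_alg \<Rightarrow> bool" where
  "zinbiel_2_subalgebra Z E \<longleftrightarrow>
     zinbiel_2_algebra Z \<and> zinbiel_2_algebra E \<and>
     sub_vspace (sp1 Z) (sp1 E) \<and> sub_vspace (sp0 Z) (sp0 E) \<and>
     (\<forall>x \<in> vecs (sp1 Z). bdry E x = bdry Z x) \<and>
     (\<forall>x \<in> vecs (sp1 Z). \<forall>y \<in> vecs (sp1 Z). mul1 E x y = mul1 Z x y) \<and>
     (\<forall>x \<in> vecs (sp0 Z). \<forall>y \<in> vecs (sp0 Z). mul0 E x y = mul0 Z x y) \<and>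
     (\<forall>x0 \<in> vecs (sp0 Z). \<forall>x1 \<in> vecs (sp1 Z).
        lact E x0 x1 = lact Z x0 x1 \<and> ract E x1 x0 = ract Z x1 x0)"

definition zinbiel_2_ideal ::
  "('k::field, 'a::ab_group_add, 'b::ab_group_add) two_alg \<Rightarrow> ('k, 'a, 'b) two_alg \<Rightarrow> bool" where
  "zinbiel_2_ideal Z E \<longleftrightarrow>
     zinbiel_2_subalgebra Z E \<and>
     (\<forall>z \<in> vecs (sp1 Z). \<forall>e \<in> vecs (sp1 E).
        mul1 E z e \<in> vecs (sp1 Z) \<and> mul1 E e z \<in> vecs (sp1 Z)) \<and>
     (\<forall>z \<in> vecs (sp0 Z). \<forall>e \<in> vecs (sp0 E).
        mul0 E z e \<in> vecs (sp0 Z) \<and> mul0 E e z \<in> vecs (sp0 Z)) \<and>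
     (\<forall>e0 \<in> vecs (sp0 E). \<forall>z1 \<in> vecs (sp1 Z).
        lact E e0 z1 \<in> vecs (sp1 Z) \<and> ract E z1 e0 \<in> vecs (sp1 Z)) \<and>
     (\<forall>z0 \<in> vecs (sp0 Z). \<forall>e1 \<in> vecs (sp1 E).
        lact E z0 e1 \<in> vecs (sp1 Z) \<and> ract E e1 z0 \<in> vecs (sp1 Z))"

text \<open>
  \<open>rh\<close>, \<open>lh\<close>, \<open>om\<close> and \<open>ast\<close> stand for $\rightharpoonup$, $\leftharpoonup$, $\omega$ and $\ast$.
  The types \<open>'z1\<close>, \<open>'z0\<close>, \<open>'v1\<close>, \<open>'v0\<close> are those of \<open>Z\<^sub>1\<close>, \<open>Z\<^sub>0\<close>, \<open>V\<^sub>1\<close>, \<open>V\<^sub>0\<close>.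
\<close>

record ('z1, 'z0, 'v1, 'v0) crossed_data =
  sigma :: "'v1 \<Rightarrow> 'z0"
  rh0 :: "'v0 \<Rightarrow> 'z0 \<Rightarrow> 'z0"
  rh1 :: "'v1 \<Rightarrow> 'z1 \<Rightarrow> 'z1"
  rh2 :: "'v0 \<Rightarrow> 'z1 \<Rightarrow> 'z1"
  rh3 :: "'v1 \<Rightarrow> 'z0 \<Rightarrow> 'z1"
  lh0 :: "'z0 \<Rightarrow> 'v0 \<Rightarrow> 'z0"
  lh1 :: "'z1 \<Rightarrow> 'v1 \<Rightarrow> 'z1"
  lh2 :: "'z0 \<Rightarrow> 'v1 \<Rightarrow> 'z1"
  lh3 :: "'z1 \<Rightarrow> 'v0 \<Rightarrow> 'z1"
  om0 :: "'v0 \<Rightarrow> 'v0 \<Rightarrow> 'z0"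
  om1 :: "'v1 \<Rightarrow> 'v1 \<Rightarrow> 'z1"
  om2 :: "'v0 \<Rightarrow> 'v1 \<Rightarrow> 'z1"
  om3 :: "'v1 \<Rightarrow> 'v0 \<Rightarrow> 'z1"
  ast0 :: "'v0 \<Rightarrow> 'v0 \<Rightarrow> 'v0"
  ast1 :: "'v1 \<Rightarrow> 'v1 \<Rightarrow> 'v1"
  ast2 :: "'v0 \<Rightarrow> 'v1 \<Rightarrow> 'v1"
  ast3 :: "'v1 \<Rightarrow> 'v0 \<Rightarrow> 'v1"

definition crossed_product ::
  "('k::field, 'z1::ab_group_add, 'z0::ab_group_add) two_alg \<Rightarrow>
   ('k, 'v1::ab_group_add, 'v0::ab_group_add) two_space \<Rightarrow>
   ('z1, 'z0, 'v1, 'v0) crossed_data \<Rightarrow> ('k, 'z1 \<times> 'v1, 'z0 \<times> 'v0) two_alg" where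
  "crossed_product Z V C =
     \<lparr>sp1 = direct_sum (sp1 Z) (sp1 V),
      sp0 = direct_sum (sp0 Z) (sp0 V),
      bdry = (\<lambda>(x, u). (bdry Z x + sigma C u, bdry V u)),
      mul1 = (\<lambda>(x, u) (y, v). (mul1 Z x y + lh1 C x v + rh1 C u y + om1 C u v, ast1 C u v)),
      mul0 = (\<lambda>(x, u) (y, v). (mul0 Z x y + lh0 C x v + rh0 C u y + om0 C u v, ast0 C u v)),
      lact = (\<lambda>(x0, u0) (x1, u1).
        (lact Z x0 x1 + lh2 C x0 u1 + rh2 C u0 x1 + om2 C u0 u1, ast2 C u0 u1)),
      ract = (\<lambda>(x1, u1) (x0, u0).
        (ract Z x1 x0 + lh3 C x1 u0 + rh3 C u1 x0 + om3 C u1 u0, ast3 C u1 u0))\<rparr>"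

definition crossed_system ::
  "('k::field, 'z1::ab_group_add, 'z0::ab_group_add) two_alg \<Rightarrow>
   ('k, 'v1::ab_group_add, 'v0::ab_group_add) two_space \<Rightarrow>
   ('z1, 'z0, 'v1, 'v0) crossed_data \<Rightarrow> bool" where
  "crossed_system Z V C \<longleftrightarrow>
     zinbiel_2_algebra Z \<and> is_two_space V \<and>
     linear_map (sp1 V) (sp0 Z) (sigma C) \<and>
     bilinear_map (sp0 V) (sp0 Z) (sp0 Z) (rh0 C) \<and>
     bilinear_map (sp1 V) (sp1 Z) (sp1 Z) (rh1 C) \<and>
     bilinear_map (sp0 V) (sp1 Z) (sp1 Z) (rh2 C) \<and>
     bilinear_map (sp1 V) (sp0 Z) (sp1 Z) (rh3 C) \<and>
     bilinear_map (sp0 Z) (sp0 V) (sp0 Z) (lh0 C) \<and>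
     bilinear_map (sp1 Z) (sp1 V) (sp1 Z) (lh1 C) \<and>
     bilinear_map (sp0 Z) (sp1 V) (sp1 Z) (lh2 C) \<and>
     bilinear_map (sp1 Z) (sp0 V) (sp1 Z) (lh3 C) \<and>
     bilinear_map (sp0 V) (sp0 V) (sp0 Z) (om0 C) \<and>
     bilinear_map (sp1 V) (sp1 V) (sp1 Z) (om1 C) \<and>
     bilinear_map (sp0 V) (sp1 V) (sp1 Z) (om2 C) \<and>
     bilinear_map (sp1 V) (sp0 V) (sp1 Z) (om3 C) \<and>
     bilinear_map (sp0 V) (sp0 V) (sp0 V) (ast0 C) \<and>
     bilinear_map (sp1 V) (sp1 V) (sp1 V) (ast1 C) \<and>
     bilinear_map (sp0 V) (sp1 V) (sp1 V) (ast2 C) \<and>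
     bilinear_map (sp1 V) (sp0 V) (sp1 V) (ast3 C) \<and>
     zinbiel_2_algebra (crossed_product Z V C)"

end

theory Submission
  imports Defs
begin

text \<open>
  Choose linear projections \<open>p\<^sub>i\<close> of \<open>E\<^sub>i\<close> onto \<open>Z\<^sub>i\<close> and put \<open>V\<^sub>i = ker p\<^sub>i\<close>, so that
  \<open>e \<mapsto> (p\<^sub>i e, e - p\<^sub>i e)\<close> is a linear bijection of \<open>E\<^sub>i\<close> with \<open>Z\<^sub>i \<oplus> V\<^sub>i\<close>. Expand a product
  of two elements of \<open>E\<close> along this decomposition: since \<open>Z\<close> is an ideal, only the
  component of \<open>V\<close> by \<open>V\<close> may leave \<open>Z\<close>, and splitting it with \<open>p\<^sub>i\<close> yields \<open>\<omega>\<close> and \<open>\<ast>\<close>.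
  The crossed product is thus the structure of \<open>E\<close> transported along the bijection, and so
  it satisfies the axioms of a Zinbiel 2-algebra.
\<close>

section \<open>Linear and bilinear maps on carriers\<close>

lemma is_vspaceD:
  assumes "is_vspace V"
  shows "0 \<in> vecs V"
    and "x \<in> vecs V \<Longrightarrow> y \<in> vecs V \<Longrightarrow> x + y \<in> vecs V"
    and "x \<in> vecs V \<Longrightarrow> y \<in> vecs V \<Longrightarrow> x - y \<in> vecs V"
    and "x \<in> vecs V \<Longrightarrow> scl V c x \<in> vecs V"
    and "scl V c (z + w) = scl V c z + scl V c w"
    and "scl V c (z - w) = scl V c z - scl V c w"
proof -
  interpret vector_space "scl V"
    using assms by (simp add: is_vspace_def)
  have sub: "subspace (vecs V)"
    using assms by (simp add: is_vspace_def)
  show "0 \<in> vecs V" "x \<in> vecs V \<Longrightarrow> y \<in> vecs V \<Longrightarrow> x + y \<in> vecs V"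
    "x \<in> vecs V \<Longrightarrow> y \<in> vecs V \<Longrightarrow> x - y \<in> vecs V" "x \<in> vecs V \<Longrightarrow> scl V c x \<in> vecs V"
    using sub by (simp_all add: subspace_0 subspace_add subspace_diff subspace_scale)
  show "scl V c (z + w) = scl V c z + scl V c w" "scl V c (z - w) = scl V c z - scl V c w"
    by (simp_all add: scale_right_distrib scale_right_diff_distrib)
qed

lemma is_vspace_direct_sum:
  assumes "is_vspace V" and "is_vspace W"
  shows "is_vspace (direct_sum V W)"
proof -
  interpret V: vector_space "scl V" using assms by (simp add: is_vspace_def)
  interpret W: vector_space "scl W" using assms by (simp add: is_vspace_def)
  interpret S: vector_space "scl (direct_sum V W)"
    by unfold_locales
      (auto simp: direct_sum_def V.scale_right_distrib W.scale_right_distrib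
        V.scale_left_distrib W.scale_left_distrib)
  have "S.subspace (vecs (direct_sum V W))"
    by (rule S.subspaceI)
      (auto simp: direct_sum_def zero_prod_def is_vspaceD[OF assms(1)] is_vspaceD[OF assms(2)])
  then show ?thesis
    by (simp add: is_vspace_def S.vector_space_axioms)
qed

lemma linear_mapD:
  assumes "linear_map V W f"
  shows "x \<in> vecs V \<Longrightarrow> f x \<in> vecs W"
    and "x \<in> vecs V \<Longrightarrow> y \<in> vecs V \<Longrightarrow> f (x + y) = f x + f y"
    and "x \<in> vecs V \<Longrightarrow> f (scl V c x) = scl W c (f x)"
  using assms by (auto simp: linear_map_def)

lemma linear_map_diff:
  assumes "is_vspace V" and "linear_map V W f" and "x \<in> vecs V" and "y \<in> vecs V"
  shows "f (x - y) = f x - f y"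
proof -
  have "f (x - y + y) = f (x - y) + f y"
    using assms by (intro linear_mapD(2)) (auto intro: is_vspaceD)
  then show ?thesis
    by (simp add: algebra_simps)
qed

lemma linear_map_comp:
  "linear_map U V f \<Longrightarrow> linear_map V W g \<Longrightarrow> linear_map U W (\<lambda>x. g (f x))"
  by (simp add: linear_map_def)

lemma linear_map_restrict:
  "linear_map V W f \<Longrightarrow> sub_vspace U V \<Longrightarrow> linear_map U W f"
  unfolding linear_map_def sub_vspace_def by (simp add: subset_iff)

lemma bilinear_mapD:
  assumes "bilinear_map U V W m"
  shows "x \<in> vecs U \<Longrightarrow> y \<in> vecs V \<Longrightarrow> m x y \<in> vecs W"
    and "x \<in> vecs U \<Longrightarrow> x' \<in> vecs U \<Longrightarrow> y \<in> vecs V \<Longrightarrow> m (x + x') y = m x y + m x' y"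
    and "x \<in> vecs U \<Longrightarrow> y \<in> vecs V \<Longrightarrow> y' \<in> vecs V \<Longrightarrow> m x (y + y') = m x y + m x y'"
  using assms by (auto simp: bilinear_map_def linear_map_def)

lemma bilinear_map_comp:
  "bilinear_map U V W m \<Longrightarrow> linear_map W X f \<Longrightarrow> bilinear_map U V X (\<lambda>x y. f (m x y))"
  by (simp add: bilinear_map_def linear_map_def)

lemma bilinear_map_restrict:
  "bilinear_map U V W m \<Longrightarrow> sub_vspace U' U \<Longrightarrow> sub_vspace V' V \<Longrightarrow> bilinear_map U' V' W m"
  by (simp add: bilinear_map_def linear_map_def sub_vspace_def subset_iff)

lemma bilinear_map_corestrict:
  "bilinear_map U V W m \<Longrightarrow> sub_vspace W' W \<Longrightarrow>
    (\<And>x y. x \<in> vecs U \<Longrightarrow> y \<in> vecs V \<Longrightarrow> m x y \<in> vecs W') \<Longrightarrow> bilinear_map U V W' m"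
  by (simp add: bilinear_map_def linear_map_def sub_vspace_def)

section \<open>Transport of structure along surjections and isomorphisms\<close>

lemma bilinear_map_image:
  assumes m: "bilinear_map U V W m"
    and f: "linear_map U U' f" "f ` vecs U = vecs U'"
    and g: "linear_map V V' g" "g ` vecs V = vecs V'"
    and h: "linear_map W W' h"
    and sp: "is_vspace U" "is_vspace V"
    and n: "\<And>x y. x \<in> vecs U \<Longrightarrow> y \<in> vecs V \<Longrightarrow> h (m x y) = n (f x) (g y)"
  shows "bilinear_map U' V' W' n"
proof -
  have "linear_map V' W' (n (f x))" if x: "x \<in> vecs U" for x
  proof -
    have "linear_map V W (m x)"
      using m x by (simp add: bilinear_map_def)
    then have hm: "linear_map V W' (\<lambda>y. h (m x y))"
      using h by (rule linear_map_comp)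
    show ?thesis
      \<comment> \<open>Every element of \<open>V'\<close> is some \<open>g y\<close>. Read from
        right to left, the linearity of \<open>g\<close> gathers an argument into a single
        \<open>g y\<close>, and \<open>n\<close> then turns \<open>n (f x) (g y)\<close> into
        \<open>h (m x y)\<close>, which is linear in \<open>y\<close>.\<close>
      unfolding linear_map_def g(2)[symmetric] ball_simps
      using is_vspaceD[OF sp(2)] x
      by (simp flip: n linear_mapD(2)[OF g(1)] linear_mapD(3)[OF g(1)] add: linear_mapD[OF hm])
  qed
  moreover have "linear_map U' W' (\<lambda>a. n a (g y))" if y: "y \<in> vecs V" for y
  proof -
    have "linear_map U W (\<lambda>x. m x y)"
      using m y by (simp add: bilinear_map_def)
    then have hm: "linear_map U W' (\<lambda>x. h (m x y))"
      using h by (rule linear_map_comp)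
    show ?thesis
      unfolding linear_map_def f(2)[symmetric] ball_simps
      using is_vspaceD[OF sp(1)] y
      by (simp flip: n linear_mapD(2)[OF f(1)] linear_mapD(3)[OF f(1)] add: linear_mapD[OF hm])
  qed
  ultimately show ?thesis
    unfolding bilinear_map_def f(2)[symmetric] g(2)[symmetric] by blast
qed

text \<open>Since \<open>f1\<close> and \<open>f0\<close> are onto, each axiom of \<open>W\<close>
  is the image of the same axiom of \<open>E\<close>. This spares checking the axioms of a crossed
  product by computation. About \<open>W\<close> itself only the two carriers have to be known to be
  vector spaces.\<close>

lemma zinbiel_2_algebra_iso_image:
  assumes E: "zinbiel_2_algebra E" and iso: "zinbiel_2_iso E W f1 f0"
    and W: "is_vspace (sp1 W)" "is_vspace (sp0 W)"
  shows "zinbiel_2_algebra W"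
proof -
  have im: "vecs (sp1 W) = f1 ` vecs (sp1 E)" "vecs (sp0 W) = f0 ` vecs (sp0 E)"
    and lin: "linear_map (sp1 E) (sp1 W) f1" "linear_map (sp0 E) (sp0 W) f0"
    and mul: "\<And>x y. x \<in> vecs (sp1 E) \<Longrightarrow> y \<in> vecs (sp1 E) \<Longrightarrow>
        f1 (mul1 E x y) = mul1 W (f1 x) (f1 y)"
      "\<And>x y. x \<in> vecs (sp0 E) \<Longrightarrow> y \<in> vecs (sp0 E) \<Longrightarrow> f0 (mul0 E x y) = mul0 W (f0 x) (f0 y)"
      "\<And>x y. x \<in> vecs (sp0 E) \<Longrightarrow> y \<in> vecs (sp1 E) \<Longrightarrow> f1 (lact E x y) = lact W (f0 x) (f1 y)"
      "\<And>x y. x \<in> vecs (sp1 E) \<Longrightarrow> y \<in> vecs (sp0 E) \<Longrightarrow> f1 (ract E x y) = ract W (f1 x) (f0 y)"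
    and bd: "\<And>x. x \<in> vecs (sp1 E) \<Longrightarrow> f0 (bdry E x) = bdry W (f1 x)"
    using iso by (auto simp: zinbiel_2_iso_def zinbiel_hom_def bij_betw_def)
  have sp: "is_vspace (sp1 E)" "is_vspace (sp0 E)"
    and bil: "bilinear_map (sp1 E) (sp1 E) (sp1 E) (mul1 E)"
      "bilinear_map (sp0 E) (sp0 E) (sp0 E) (mul0 E)"
      "bilinear_map (sp0 E) (sp1 E) (sp1 E) (lact E)"
      "bilinear_map (sp1 E) (sp0 E) (sp1 E) (ract E)"
    and linb: "linear_map (sp1 E) (sp0 E) (bdry E)"
    using E by (simp_all add: zinbiel_2_algebra_def zinbiel_algebra_def zinbiel_action_def
        zinbiel_bimodule_def zinbiel_hom_def)
  have bilW: "bilinear_map (sp1 W) (sp1 W) (sp1 W) (mul1 W)"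
      "bilinear_map (sp0 W) (sp0 W) (sp0 W) (mul0 W)"
      "bilinear_map (sp0 W) (sp1 W) (sp1 W) (lact W)"
      "bilinear_map (sp1 W) (sp0 W) (sp1 W) (ract W)"
    by (rule bilinear_map_image[OF bil(1) lin(1) _ lin(1) _ lin(1) sp(1) sp(1)]
        bilinear_map_image[OF bil(2) lin(2) _ lin(2) _ lin(2) sp(2) sp(2)]
        bilinear_map_image[OF bil(3) lin(2) _ lin(1) _ lin(1) sp(2) sp(1)]
        bilinear_map_image[OF bil(4) lin(1) _ lin(2) _ lin(1) sp(1) sp(2)];
      simp add: im mul)+
  have bdW: "linear_map (sp1 W) (sp0 W) (bdry W)"
    unfolding linear_map_def im(1) ball_simps
    using is_vspaceD[OF sp(1)] linear_mapD[OF linear_map_comp[OF linb lin(2)]]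
    by (simp flip: bd linear_mapD(2)[OF lin(1)] linear_mapD(3)[OF lin(1)])
  note closed = bilinear_mapD(1)[OF bil(1)] bilinear_mapD(1)[OF bil(2)]
    bilinear_mapD(1)[OF bil(3)] bilinear_mapD(1)[OF bil(4)] linear_mapD(1)[OF linb]
    is_vspaceD(2)[OF sp(1)] is_vspaceD(2)[OF sp(2)]
  note defs = zinbiel_2_algebra_def zinbiel_algebra_def zinbiel_action_def
    zinbiel_bimodule_def zinbiel_hom_def
  show ?thesis
    unfolding defs
    \<comment> \<open>The first \<open>simp\<close> settles all linearity conditions. The second
      pulls \<open>f1\<close> and \<open>f0\<close> outwards, so that each remaining identity
      equates two values of the same map; \<open>arg_cong\<close> then leaves an axiom of
      \<open>E\<close>.\<close>
    by (simp add: W bilW bdW)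
       (simp add: im closed flip: mul bd linear_mapD(2)[OF lin(1)] linear_mapD(2)[OF lin(2)],
        intro conjI ballI; rule arg_cong[where f = f1] arg_cong[where f = f0];
        use E[unfolded defs] in blast)
qed

section \<open>Projections onto subspaces and their kernels as complements\<close>

definition projection ::
  "('k::field, 'a::ab_group_add) vspace \<Rightarrow> ('k, 'a) vspace \<Rightarrow> ('a \<Rightarrow> 'a) \<Rightarrow> bool" where
  "projection U V p \<longleftrightarrow> sub_vspace U V \<and> linear_map V U p \<and> (\<forall>x \<in> vecs U. p x = x)"

text \<open>For a projection this is a complement of its image. It stays in the ambient type and
  keeps the scalars of \<open>V\<close>, so the complements in the theorem have the types of
  \<open>E\<close>.\<close>

definition ker_space ::
  "('k::field, 'a::ab_group_add) vspace \<Rightarrow> ('a \<Rightarrow> 'a) \<Rightarrow> ('k, 'a) vspace" where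
  "ker_space V p = \<lparr>vecs = {x \<in> vecs V. p x = 0}, scl = scl V\<rparr>"

text \<open>The identity is injective on the subspace, hence has a linear left inverse on it with
  values in \<open>U\<close>. That map is linear on the whole type and is then restricted to
  \<open>vecs V\<close>.\<close>

lemma projection_exists:
  assumes "sub_vspace U V"
  shows "\<exists>p. projection U V p"
proof -
  interpret vector_space "scl V"
    using assms by (simp add: sub_vspace_def is_vspace_def)
  interpret vector_space_pair "scl V" "scl V" ..
  have UV: "is_vspace U" "\<And>c x. x \<in> vecs U \<Longrightarrow> scl U c x = scl V c x"
    using assms by (simp_all add: sub_vspace_def)
  \<comment> \<open>\<open>U\<close> has its own scalar multiplication, which agrees with that of
    \<open>V\<close> on \<open>vecs U\<close> only; this suffices for \<open>vecs U\<close> to be a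
    subspace for \<open>scl V\<close>.\<close>
  have "subspace (vecs U)"
    using is_vspaceD(1,2,4)[OF UV(1)] by (auto simp: UV(2) intro!: subspaceI)
  then obtain p where p: "range p \<subseteq> vecs U" "Vector_Spaces.linear (scl V) (scl V) p"
    "\<forall>x\<in>vecs U. p x = x"
    using linear_exists_left_inverse_on[OF linear_id, of "vecs U"] by auto
  interpret p: Vector_Spaces.linear "scl V" "scl V" p by (fact p(2))
  have "linear_map V U p"
    using p(1) by (auto simp: linear_map_def p.add p.scale UV(2) image_subset_iff)
  then show ?thesis
    using assms p(3) by (auto simp: projection_def)
qed

context
  fixes U V :: "('k::field, 'a::ab_group_add) vspace" and p :: "'a \<Rightarrow> 'a"
  assumes proj: "projection U V p"
begin

lemma projectionD:
  shows "is_vspace U" and "is_vspace V" and "sub_vspace U V" and "linear_map V U p"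
    and "x \<in> vecs U \<Longrightarrow> x \<in> vecs V" and "x \<in> vecs U \<Longrightarrow> p x = x"
    and "x \<in> vecs U \<Longrightarrow> scl U c x = scl V c x"
  using proj by (auto simp: projection_def sub_vspace_def)

lemma linear_map_projection: "linear_map V V p"
  using projectionD by (auto simp: linear_map_def)

lemma sub_vspace_ker_space: "sub_vspace (ker_space V p) V"
proof -
  interpret vector_space "scl V"
    using projectionD(2) by (simp add: is_vspace_def)
  have p0: "p 0 = 0"
    using linear_map_diff[OF projectionD(2,4), of 0 0] is_vspaceD(1)[OF projectionD(2)] by simp
  have "subspace {x \<in> vecs V. p x = 0}"
    using is_vspaceD[OF projectionD(2)] linear_mapD[OF linear_map_projection]
    by (intro subspaceI) (auto simp: p0)
  then show ?thesis
    using projectionD(2) by (auto simp: sub_vspace_def ker_space_def is_vspace_def)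
qed

lemma linear_map_complement: "linear_map V (ker_space V p) (\<lambda>x. x - p x)"
  using is_vspaceD[OF projectionD(2)] linear_mapD[OF linear_map_projection]
    linear_mapD(1)[OF projectionD(4)] projectionD(5,6)
    linear_map_diff[OF projectionD(2) projectionD(4)]
  by (simp add: linear_map_def ker_space_def)

lemma linear_map_decomposition:
  "linear_map V (direct_sum U (ker_space V p)) (\<lambda>x. (p x, x - p x))"
  using linear_map_complement projectionD(4) by (simp add: linear_map_def direct_sum_def)

text \<open>Addition is the inverse: for \<open>x\<close> in \<open>U\<close> and \<open>u\<close>
  in the kernel, \<open>p (x + u) = x\<close>, which leaves \<open>u\<close> as the other
  component.\<close>

lemma bij_betw_decomposition:
  "bij_betw (\<lambda>x. (p x, x - p x)) (vecs V) (vecs (direct_sum U (ker_space V p)))"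
proof (rule bij_betwI[where g = "\<lambda>(x, u). x + u"])
  show "(\<lambda>x. (p x, x - p x)) \<in> vecs V \<rightarrow> vecs (direct_sum U (ker_space V p))"
    using linear_mapD(1)[OF linear_map_decomposition] by blast
  show "(\<lambda>(x, u). x + u) \<in> vecs (direct_sum U (ker_space V p)) \<rightarrow> vecs V"
    using is_vspaceD(2)[OF projectionD(2)] projectionD(5)
    by (auto simp: direct_sum_def ker_space_def)
qed (use linear_mapD(2)[OF linear_map_projection] projectionD(5,6)
    in \<open>auto simp: direct_sum_def ker_space_def\<close>)

end

section \<open>Splitting a bilinear map along complements\<close>

text \<open>Expand \<open>m (p x + u) (q y + v)\<close>. By \<open>l\<close> and \<open>i\<close>,
  the three terms with a factor in \<open>UA\<close> or \<open>UB\<close> lie in \<open>UC\<close>,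
  so \<open>r\<close> fixes them and they drop out of the complementary component. Keeping three
  separate projections lets one lemma serve both products and both actions.\<close>

lemma bilinear_map_decompose:
  assumes A: "projection UA A p" and B: "projection UB B q" and C: "projection UC C r"
    and m: "bilinear_map A B C m"
    and l: "\<And>x y. x \<in> vecs UA \<Longrightarrow> y \<in> vecs B \<Longrightarrow> m x y \<in> vecs UC"
    and i: "\<And>x y. x \<in> vecs A \<Longrightarrow> y \<in> vecs UB \<Longrightarrow> m x y \<in> vecs UC"
    and x: "x \<in> vecs A" and y: "y \<in> vecs B"
  defines "u \<equiv> x - p x" and "v \<equiv> y - q y"
  shows "r (m x y) = m (p x) (q y) + m (p x) v + m u (q y) + r (m u v)"
    and "m x y - r (m x y) = m u v - r (m u v)"
proof -
  have px: "p x \<in> vecs UA" "p x \<in> vecs A" and qy: "q y \<in> vecs UB" "q y \<in> vecs B"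
    using linear_mapD(1)[OF projectionD(4)] projectionD(5) A B x y by blast+
  have uv: "u \<in> vecs A" "v \<in> vecs B"
    using px qy x y is_vspaceD(3)[OF projectionD(2)] A B unfolding u_def v_def by blast+
  define z where "z = m (p x) (q y) + m (p x) v + m u (q y)"
  have z: "z \<in> vecs UC"
    unfolding z_def using px qy uv l i by (intro is_vspaceD(2)[OF projectionD(1)[OF C]]) auto
  have "m (p x + u) (q y + v) = z + m u v"
    using px qy uv is_vspaceD(2)[OF projectionD(2)[OF B]]
    by (simp add: bilinear_mapD[OF m] z_def algebra_simps)
  then have m_eq: "m x y = z + m u v"
    by (simp add: u_def v_def)
  have "r (m x y) = z + r (m u v)"
    using z bilinear_mapD(1)[OF m uv] projectionD(5,6)[OF C z]
    by (simp add: m_eq linear_mapD(2)[OF projectionD(4)[OF C]])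
  then show "r (m x y) = m (p x) (q y) + m (p x) v + m u (q y) + r (m u v)"
    "m x y - r (m x y) = m u v - r (m u v)"
    by (simp_all add: m_eq z_def)
qed

text \<open>For one operation \<open>m\<close> of \<open>E\<close>, these four maps become
  \<open>lh\<close>, \<open>rh\<close>, \<open>om\<close> and \<open>ast\<close> of the crossed
  system, in this order. The first two take values in \<open>UC\<close> by the ideal conditions
  \<open>l\<close> and \<open>i\<close>, the last two by composing with \<open>r\<close> and with
  its complement.\<close>

lemma bilinear_map_components:
  assumes A: "projection UA A p" and B: "projection UB B q" and C: "projection UC C r"
    and m: "bilinear_map A B C m"
    and l: "\<And>x y. x \<in> vecs UA \<Longrightarrow> y \<in> vecs B \<Longrightarrow> m x y \<in> vecs UC"
    and i: "\<And>x y. x \<in> vecs A \<Longrightarrow> y \<in> vecs UB \<Longrightarrow> m x y \<in> vecs UC"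
  shows "bilinear_map UA (ker_space B q) UC m"
    and "bilinear_map (ker_space A p) UB UC m"
    and "bilinear_map (ker_space A p) (ker_space B q) UC (\<lambda>x y. r (m x y))"
    and "bilinear_map (ker_space A p) (ker_space B q) (ker_space C r) (\<lambda>x y. m x y - r (m x y))"
proof -
  note sA = sub_vspace_ker_space[OF A] and sB = sub_vspace_ker_space[OF B]
  note mk = bilinear_map_restrict[OF m sA sB]
  show "bilinear_map (ker_space A p) (ker_space B q) UC (\<lambda>x y. r (m x y))"
    using bilinear_map_comp[OF mk projectionD(4)[OF C]] .
  show "bilinear_map (ker_space A p) (ker_space B q) (ker_space C r) (\<lambda>x y. m x y - r (m x y))"
    using bilinear_map_comp[OF mk linear_map_complement[OF C]] .
  show "bilinear_map UA (ker_space B q) UC m"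
    using bilinear_map_restrict[OF m projectionD(3)[OF A] sB] projectionD(3)[OF C]
    by (rule bilinear_map_corestrict) (use l in \<open>auto simp: ker_space_def\<close>)
  show "bilinear_map (ker_space A p) UB UC m"
    using bilinear_map_restrict[OF m sA projectionD(3)[OF B]] projectionD(3)[OF C]
    by (rule bilinear_map_corestrict) (use i in \<open>auto simp: ker_space_def\<close>)
qed

section \<open>The crossed system of an ideal\<close>

theorem corollary3p3:
  fixes Z :: "('k::alg_closed_field, 'a::ab_group_add, 'b::ab_group_add) two_alg"
    and F :: "('k, 'a, 'b) two_space"
    and E :: "('k, 'a, 'b) two_alg"
  assumes "CHAR('k) \<noteq> 2" and "CHAR('k) \<noteq> 3"
    and "zinbiel_2_algebra Z"
    and "is_two_space F"
    and "zinbiel_2_algebra E" and "two_space.truncate E = F"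
    and "zinbiel_2_ideal Z E"
  shows "\<exists>(V :: ('k, 'a, 'b) two_space) (C :: ('a, 'b, 'a, 'b) crossed_data).
           crossed_system Z V C \<and> zinbiel_2_isomorphic E (crossed_product Z V C)"
proof -
  have bil: "bilinear_map (sp1 E) (sp1 E) (sp1 E) (mul1 E)"
      "bilinear_map (sp0 E) (sp0 E) (sp0 E) (mul0 E)"
      "bilinear_map (sp0 E) (sp1 E) (sp1 E) (lact E)"
      "bilinear_map (sp1 E) (sp0 E) (sp1 E) (ract E)"
    and linb: "linear_map (sp1 E) (sp0 E) (bdry E)"
    using \<open>zinbiel_2_algebra E\<close> by (simp_all add: zinbiel_2_algebra_def zinbiel_algebra_def
        zinbiel_action_def zinbiel_bimodule_def zinbiel_hom_def)
  have linbZ: "linear_map (sp1 Z) (sp0 Z) (bdry Z)"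
    using \<open>zinbiel_2_algebra Z\<close> by (simp add: zinbiel_2_algebra_def zinbiel_hom_def)
  have sub: "sub_vspace (sp1 Z) (sp1 E)" "sub_vspace (sp0 Z) (sp0 E)"
    and bd: "\<And>x. x \<in> vecs (sp1 Z) \<Longrightarrow> bdry E x = bdry Z x"
    and ops: "\<And>x y. x \<in> vecs (sp1 Z) \<Longrightarrow> y \<in> vecs (sp1 Z) \<Longrightarrow> mul1 Z x y = mul1 E x y"
      "\<And>x y. x \<in> vecs (sp0 Z) \<Longrightarrow> y \<in> vecs (sp0 Z) \<Longrightarrow> mul0 Z x y = mul0 E x y"
      "\<And>x y. x \<in> vecs (sp0 Z) \<Longrightarrow> y \<in> vecs (sp1 Z) \<Longrightarrow> lact Z x y = lact E x y"
      "\<And>x y. x \<in> vecs (sp1 Z) \<Longrightarrow> y \<in> vecs (sp0 Z) \<Longrightarrow> ract Z x y = ract E x y"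
    using \<open>zinbiel_2_ideal Z E\<close> by (simp_all add: zinbiel_2_ideal_def zinbiel_2_subalgebra_def)
  have ideal:
    "\<And>x y. x \<in> vecs (sp1 Z) \<Longrightarrow> y \<in> vecs (sp1 E) \<Longrightarrow> mul1 E x y \<in> vecs (sp1 Z)"
    "\<And>x y. x \<in> vecs (sp1 E) \<Longrightarrow> y \<in> vecs (sp1 Z) \<Longrightarrow> mul1 E x y \<in> vecs (sp1 Z)"
    "\<And>x y. x \<in> vecs (sp0 Z) \<Longrightarrow> y \<in> vecs (sp0 E) \<Longrightarrow> mul0 E x y \<in> vecs (sp0 Z)"
    "\<And>x y. x \<in> vecs (sp0 E) \<Longrightarrow> y \<in> vecs (sp0 Z) \<Longrightarrow> mul0 E x y \<in> vecs (sp0 Z)"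
    "\<And>x y. x \<in> vecs (sp0 Z) \<Longrightarrow> y \<in> vecs (sp1 E) \<Longrightarrow> lact E x y \<in> vecs (sp1 Z)"
    "\<And>x y. x \<in> vecs (sp0 E) \<Longrightarrow> y \<in> vecs (sp1 Z) \<Longrightarrow> lact E x y \<in> vecs (sp1 Z)"
    "\<And>x y. x \<in> vecs (sp1 Z) \<Longrightarrow> y \<in> vecs (sp0 E) \<Longrightarrow> ract E x y \<in> vecs (sp1 Z)"
    "\<And>x y. x \<in> vecs (sp1 E) \<Longrightarrow> y \<in> vecs (sp0 Z) \<Longrightarrow> ract E x y \<in> vecs (sp1 Z)"
    using \<open>zinbiel_2_ideal Z E\<close> by (simp_all add: zinbiel_2_ideal_def)
  obtain p1 p0 where p1: "projection (sp1 Z) (sp1 E) p1" and p0: "projection (sp0 Z) (sp0 E) p0"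
    using projection_exists sub by meson
  \<comment> \<open>\<open>bdry E\<close> need not map one kernel into the other. Its component in
    the kernel of \<open>p0\<close> serves as the structure map of \<open>V\<close>, its component
    in \<open>sp0 Z\<close> as \<open>sigma\<close>.\<close>
  define V :: "('k, 'a, 'b) two_space" where
    "V = \<lparr>sp1 = ker_space (sp1 E) p1, sp0 = ker_space (sp0 E) p0,
      bdry = (\<lambda>u. bdry E u - p0 (bdry E u))\<rparr>"
  \<comment> \<open>The \<open>rh\<close> and \<open>lh\<close> maps carry no projection: the ideal
    conditions already place mixed products in \<open>Z\<close>.\<close>
  define C :: "('a, 'b, 'a, 'b) crossed_data" where
    "C = \<lparr>sigma = (\<lambda>u. p0 (bdry E u)),
      rh0 = mul0 E, rh1 = mul1 E, rh2 = lact E, rh3 = ract E,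
      lh0 = mul0 E, lh1 = mul1 E, lh2 = lact E, lh3 = ract E,
      om0 = (\<lambda>u v. p0 (mul0 E u v)), om1 = (\<lambda>u v. p1 (mul1 E u v)),
      om2 = (\<lambda>u v. p1 (lact E u v)), om3 = (\<lambda>u v. p1 (ract E u v)),
      ast0 = (\<lambda>u v. mul0 E u v - p0 (mul0 E u v)), ast1 = (\<lambda>u v. mul1 E u v - p1 (mul1 E u v)),
      ast2 = (\<lambda>u v. lact E u v - p1 (lact E u v)), ast3 = (\<lambda>u v. ract E u v - p1 (ract E u v))\<rparr>"
  define f1 where "f1 = (\<lambda>x. (p1 x, x - p1 x))"
  define f0 where "f0 = (\<lambda>x. (p0 x, x - p0 x))"
  note mem = linear_mapD(1)[OF projectionD(4)[OF p1]] linear_mapD(1)[OF projectionD(4)[OF p0]]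
  \<comment> \<open>The boundary of \<open>p1 x\<close> lies in \<open>sp0 Z\<close> and is fixed by
    \<open>p0\<close>. It therefore cancels in the kernel component, and in the other one it adds up
    with \<open>sigma\<close> to \<open>p0 (bdry E x)\<close>.\<close>
  have bdry_f: "bdry (crossed_product Z V C) (f1 x) = f0 (bdry E x)" if x: "x \<in> vecs (sp1 E)" for x
  proof -
    have px: "p1 x \<in> vecs (sp1 E)" "x - p1 x \<in> vecs (sp1 E)"
      using x mem projectionD(5)[OF p1] is_vspaceD(3)[OF projectionD(2)[OF p1]] by blast+
    have bz: "bdry E (p1 x) = bdry Z (p1 x)" "bdry Z (p1 x) \<in> vecs (sp0 Z)"
      using bd mem x linear_mapD(1)[OF linbZ] by blast+
    have "bdry E (x - p1 x) = bdry E x - bdry Z (p1 x)"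
      using linear_map_diff[OF projectionD(2)[OF p1] linb x px(1)] bz by simp
    moreover have "p0 (bdry E x - bdry Z (p1 x)) = p0 (bdry E x) - bdry Z (p1 x)"
      using linear_map_diff[OF projectionD(2)[OF p0] projectionD(4)[OF p0]]
        linear_mapD(1)[OF linb x] projectionD(5,6)[OF p0 bz(2)] by simp
    ultimately show ?thesis
      by (simp add: crossed_product_def V_def C_def f1_def f0_def)
  qed
  have iso: "zinbiel_2_iso E (crossed_product Z V C) f1 f0"
    unfolding zinbiel_2_iso_def zinbiel_hom_def
  proof (intro conjI ballI)
    show "linear_map (sp1 E) (sp1 (crossed_product Z V C)) f1"
      "linear_map (sp0 E) (sp0 (crossed_product Z V C)) f0"
      "bij_betw f1 (vecs (sp1 E)) (vecs (sp1 (crossed_product Z V C)))"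
      "bij_betw f0 (vecs (sp0 E)) (vecs (sp0 (crossed_product Z V C)))"
      unfolding f1_def f0_def
      using linear_map_decomposition[OF p1] linear_map_decomposition[OF p0]
        bij_betw_decomposition[OF p1] bij_betw_decomposition[OF p0]
      by (simp_all add: crossed_product_def V_def)
  next
    \<comment> \<open>The two conclusions of \<open>bilinear_map_decompose\<close> are the two
      components of the crossed product; \<open>ops\<close> replaces the operation of
      \<open>Z\<close> by that of \<open>E\<close>. The other operations follow the same
      pattern.\<close>
    fix x y assume "x \<in> vecs (sp1 E)" "y \<in> vecs (sp1 E)"
    with bilinear_map_decompose[OF p1 p1 p1 bil(1) ideal(1,2)]
    show "f1 (mul1 E x y) = mul1 (crossed_product Z V C) (f1 x) (f1 y)"
      by (simp add: f1_def crossed_product_def C_def ops mem)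
  next
    fix x y assume "x \<in> vecs (sp0 E)" "y \<in> vecs (sp0 E)"
    with bilinear_map_decompose[OF p0 p0 p0 bil(2) ideal(3,4)]
    show "f0 (mul0 E x y) = mul0 (crossed_product Z V C) (f0 x) (f0 y)"
      by (simp add: f0_def crossed_product_def C_def ops mem)
  next
    fix x y assume xy: "x \<in> vecs (sp0 E)" "y \<in> vecs (sp1 E)"
    with bilinear_map_decompose[OF p0 p1 p1 bil(3) ideal(5,6)]
    show "f1 (lact E x y) = lact (crossed_product Z V C) (f0 x) (f1 y)"
      by (simp add: f0_def f1_def crossed_product_def C_def ops mem)
    from xy bilinear_map_decompose[OF p1 p0 p1 bil(4) ideal(7,8)]
    show "f1 (ract E y x) = ract (crossed_product Z V C) (f1 y) (f0 x)"
      by (simp add: f0_def f1_def crossed_product_def C_def ops mem)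
  qed (rule bdry_f)
  have spV: "is_vspace (sp1 V)" "is_vspace (sp0 V)"
    using sub_vspace_ker_space[OF p1] sub_vspace_ker_space[OF p0]
    by (simp_all add: V_def sub_vspace_def)
  have linb_ker: "linear_map (sp1 V) (sp0 E) (bdry E)"
    using linear_map_restrict[OF linb sub_vspace_ker_space[OF p1]] by (simp add: V_def)
  \<comment> \<open>There is no circularity: \<open>zinbiel_2_iso\<close> speaks of maps and
    operations only and does not presuppose that its target satisfies the axioms.\<close>
  have "zinbiel_2_algebra (crossed_product Z V C)"
    by (rule zinbiel_2_algebra_iso_image[OF \<open>zinbiel_2_algebra E\<close> iso])
      (simp_all add: crossed_product_def is_vspace_direct_sum spV projectionD(1)[OF p1]
        projectionD(1)[OF p0])
  moreover have "linear_map (sp1 V) (sp0 Z) (sigma C)" "is_two_space V"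
    using linear_map_comp[OF linb_ker projectionD(4)[OF p0]]
      linear_map_comp[OF linb_ker linear_map_complement[OF p0]] spV
    by (simp_all add: is_two_space_def C_def V_def)
  ultimately have "crossed_system Z V C"
    using \<open>zinbiel_2_algebra Z\<close>
      bilinear_map_components[OF p1 p1 p1 bil(1) ideal(1,2)]
      bilinear_map_components[OF p0 p0 p0 bil(2) ideal(3,4)]
      bilinear_map_components[OF p0 p1 p1 bil(3) ideal(5,6)]
      bilinear_map_components[OF p1 p0 p1 bil(4) ideal(7,8)]
    unfolding crossed_system_def by (simp add: C_def V_def)
  with iso show ?thesis
    unfolding zinbiel_2_isomorphic_def by blast
qed

end
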